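(* Let $n \geq 2$ and let $\preceq$ be a left-invariant total order relation on the free group $F_n$ on $n$ generators. Then the semigroup $\{g \in F_n : g \succ id\}$ is not finitely generated (as a semigroup).
   Context: A total order $\preceq$ on a group $\Gamma$ is left-invariant if $g \preceq h$ implies $fg \preceq fh$ for all $f,g,h \in \Gamma$. *)

theory Defs
  imports "HOL-Algebra.Group"
begin

text \<open>A letter \<open>(s, True)\<close> stands for the generator \<open>s\<close>, and \<open>(s, False)\<close> for its formal inverse.
  The free group on \<open>S\<close> is realised on the freely reduced words over such letters.\<close>

type_synonym 'a letter = "'a \<times> bool"

definition inv_letter :: "'a letter \<Rightarrow> 'a letter" where
  "inv_letter x = (fst x, \<not> snd x)"

fun reduced :: "'a letter list \<Rightarrow> bool" where
  "reduced (x # y # w) \<longleftrightarrow> y \<noteq> inv_letter x \<and> reduced (y # w)"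
| "reduced w \<longleftrightarrow> True"

text \<open>Left multiplication of a reduced word by one letter, cancelling if possible.\<close>

fun push_letter :: "'a letter \<Rightarrow> 'a letter list \<Rightarrow> 'a letter list" where
  "push_letter x [] = [x]"
| "push_letter x (y # w) = (if y = inv_letter x then w else x # y # w)"

definition free_group :: "'a set \<Rightarrow> 'a letter list monoid" where
  "free_group S =
    \<lparr>carrier = {w. reduced w \<and> fst ` set w \<subseteq> S},
     mult = \<lambda>u v. foldr push_letter u v,
     one = []\<rparr>"

lemma inv_letter_simps [simp]:
  "inv_letter (inv_letter x) = x" "inv_letter x \<noteq> x" "fst (inv_letter x) = fst x"
  by (auto simp: inv_letter_def prod_eq_iff)

lemma reduced_ConsD: "reduced (x # w) \<Longrightarrow> reduced w"
  by (cases w) auto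

lemma reduced_push_letter: "reduced w \<Longrightarrow> reduced (push_letter x w)"
  by (cases w) (auto dest: reduced_ConsD)

lemma reduced_foldr_push: "reduced v \<Longrightarrow> reduced (foldr push_letter u v)"
  by (induction u) (auto intro: reduced_push_letter)

lemma set_push_letter: "set (push_letter x w) \<subseteq> insert x (set w)"
  by (cases w) auto

lemma set_foldr_push: "set (foldr push_letter u v) \<subseteq> set u \<union> set v"
proof (induction u)
  case (Cons x u)
  then show ?case using set_push_letter[of x "foldr push_letter u v"] by auto
qed auto

lemma push_letter_inv: "reduced w \<Longrightarrow> push_letter x (push_letter (inv_letter x) w) = w"
proof (cases w)
  case (Cons y v)
  assume "reduced w"
  with Cons show ?thesis by (cases v) auto
qed auto

lemma foldr_push_push:
  assumes "reduced w"
  shows "foldr push_letter (push_letter x v) w = push_letter x (foldr push_letter v w)"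
proof (cases v)
  case (Cons y v')
  then show ?thesis
    using push_letter_inv[OF reduced_foldr_push[OF assms, of v'], of x] by auto
qed auto

lemma foldr_push_assoc:
  "reduced w \<Longrightarrow>
    foldr push_letter (foldr push_letter u v) w = foldr push_letter u (foldr push_letter v w)"
  by (induction u) (auto simp: foldr_push_push)

lemma foldr_push_Nil: "reduced w \<Longrightarrow> foldr push_letter w [] = w"
proof (induction w)
  case (Cons x w)
  then show ?case by (cases w) (auto dest: reduced_ConsD)
qed auto

lemma foldr_push_inverse:
  "reduced v \<Longrightarrow>
    foldr push_letter (rev (map inv_letter w)) (foldr push_letter w v) = v"
proof (induction w)
  case (Cons x w)
  then show ?case
    using push_letter_inv[OF reduced_foldr_push, of v "inv_letter x" w] by auto
qed auto

lemma group_free_group: "group (free_group S)"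
proof (rule groupI)
  fix u v assume "u \<in> carrier (free_group S)" "v \<in> carrier (free_group S)"
  then show "u \<otimes>\<^bsub>free_group S\<^esub> v \<in> carrier (free_group S)"
    using set_foldr_push[of u v] by (fastforce simp: free_group_def reduced_foldr_push)
next
  fix w assume w: "w \<in> carrier (free_group S)"
  define w' where "w' = foldr push_letter (rev (map inv_letter w)) []"
  have "w' \<in> carrier (free_group S)"
    using w set_foldr_push[of "rev (map inv_letter w)" "[]"]
    by (fastforce simp: free_group_def w'_def reduced_foldr_push)
  moreover have "w' \<otimes>\<^bsub>free_group S\<^esub> w = \<one>\<^bsub>free_group S\<^esub>"
    using w foldr_push_inverse[of "[]" w]
    by (simp add: free_group_def w'_def foldr_push_assoc foldr_push_Nil)
  ultimately show "\<exists>v\<in>carrier (free_group S). v \<otimes>\<^bsub>free_group S\<^esub> w = \<one>\<^bsub>free_group S\<^esub>"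
    by blast
qed (auto simp: free_group_def foldr_push_assoc)

definition left_invariant :: "('a, 'b) monoid_scheme \<Rightarrow> 'a rel \<Rightarrow> bool" where
  "left_invariant G r \<longleftrightarrow>
    (\<forall>f\<in>carrier G. \<forall>g\<in>carrier G. \<forall>h\<in>carrier G.
      (g, h) \<in> r \<longrightarrow> (f \<otimes>\<^bsub>G\<^esub> g, f \<otimes>\<^bsub>G\<^esub> h) \<in> r)"

definition positive_cone :: "('a, 'b) monoid_scheme \<Rightarrow> 'a rel \<Rightarrow> 'a set" where
  "positive_cone G r = {g \<in> carrier G. (\<one>\<^bsub>G\<^esub>, g) \<in> r \<and> g \<noteq> \<one>\<^bsub>G\<^esub>}"

text \<open>The subsemigroup generated by \<open>A\<close>: all products of one or more elements of \<open>A\<close>; unlike in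
  \<open>generate\<close>, neither inverses nor the unit are added.\<close>

inductive_set semigroup_generate :: "('a, 'b) monoid_scheme \<Rightarrow> 'a set \<Rightarrow> 'a set"
  for G and A where
  incl: "a \<in> A \<Longrightarrow> a \<in> semigroup_generate G A"
| mult: "a \<in> semigroup_generate G A \<Longrightarrow> b \<in> semigroup_generate G A \<Longrightarrow>
    a \<otimes>\<^bsub>G\<^esub> b \<in> semigroup_generate G A"

definition finitely_generated_semigroup :: "('a, 'b) monoid_scheme \<Rightarrow> 'a set \<Rightarrow> bool" where
  "finitely_generated_semigroup G P \<longleftrightarrow>
    (\<exists>A. finite A \<and> A \<subseteq> P \<and> semigroup_generate G A = P)"

end

(* Let A be a finite generating set of the positive cone, K a bound on the lengths of its elements,
   and z an element below all words of length at most K. Passing from z to a smaller element u is a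
   sequence of right multiplications by inverses of elements of A, all of whose intermediate words
   are longer than K; such a step cannot change the first letter. So every u below z starts with the
   same letter as z. For a generator y other than that of this letter, neither y z nor y^-1 z starts
   with it, hence z < y z and z < y^-1 z, and left multiplication by y turns the latter into
   y z < z. *)

theory Submission
  imports Defs
begin

text \<open>Cancellation happens only at the seam: \<open>q\<close> is the suffix of
  \<open>u\<close> that cancels against a prefix of \<open>v\<close>. Once a letter of
  \<open>u\<close> survives, all letters to its left survive too, because \<open>u\<close> is
  reduced.\<close>

lemma foldr_push_letter_decompose:
  assumes "reduced u"
  obtains p q s where "u = p @ q" and "v = rev (map inv_letter q) @ s"
    and "foldr push_letter u v = p @ s"
  using assms
proof (induction u arbitrary: thesis)
  case Nil
  from Nil(1)[of "[]" "[]" v] show ?case by simp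
next
  case (Cons x u)
  from Cons.prems(2) have "reduced u" by (rule reduced_ConsD)
  then obtain p q s where pqs: "u = p @ q" "v = rev (map inv_letter q) @ s"
    "foldr push_letter u v = p @ s"
    using Cons.IH by blast
  show ?case
  proof (cases "p = [] \<and> (\<exists>s'. s = inv_letter x # s')")
    case True
    then obtain s' where "p = []" "s = inv_letter x # s'" by blast
    with pqs show ?thesis by (intro Cons.prems(1)[of "[]" "x # q" s']) auto
  next
    case False
    have "push_letter x (p @ s) = x # p @ s"
      using False Cons.prems(2) pqs(1) by (cases p; cases s) auto
    with pqs show ?thesis by (intro Cons.prems(1)[of "x # p" q s]) auto
  qed
qed

text \<open>The suffix of \<open>u\<close> that cancels is no longer than \<open>v\<close>, so a
  nonempty prefix of \<open>u\<close> survives.\<close>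

lemma hd_foldr_push_letter:
  assumes "reduced u" and "length v < length u"
  shows "hd (foldr push_letter u v) = hd u"
  using foldr_push_letter_decompose[OF assms(1), of v] assms(2)
  by (metis hd_append2 length_append length_map length_rev not_add_less1 append_Nil)

text \<open>Left cancellation in the group keeps the two products distinct.\<close>

lemma left_invariant_strict:
  assumes "group G" and "left_invariant G r" and "f \<in> carrier G" "g \<in> carrier G" "h \<in> carrier G"
    and "(g, h) \<in> r - Id"
  shows "(f \<otimes>\<^bsub>G\<^esub> g, f \<otimes>\<^bsub>G\<^esub> h) \<in> r - Id"
proof -
  interpret group G by fact
  show ?thesis using assms by (auto simp: left_invariant_def)
qed

text \<open>A nontrivial left-ordered group has no least element: some \<open>t\<close> lies
  strictly below the identity, and left multiplication by any \<open>w\<close> puts w t strictly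
  below \<open>w\<close>.\<close>

lemma left_order_finite_strict_lower_bound:
  assumes "group G" and inv: "left_invariant G r" and lin: "linear_order_on (carrier G) r"
    and nontriv: "y \<in> carrier G" "y \<noteq> \<one>\<^bsub>G\<^esub>"
    and "finite B" "B \<subseteq> carrier G"
  obtains z where "z \<in> carrier G" and "\<And>b. b \<in> B \<Longrightarrow> (z, b) \<in> r - Id"
proof -
  interpret group G by fact
  have tot: "total_on (carrier G) r" and tr: "trans (r - Id)"
    using lin by (auto simp: order_on_defs intro: trans_diff_Id)
  have "\<exists>t\<in>carrier G. (t, \<one>\<^bsub>G\<^esub>) \<in> r - Id"
  proof (cases "(y, \<one>\<^bsub>G\<^esub>) \<in> r")
    case False
    then have "(\<one>\<^bsub>G\<^esub>, y) \<in> r - Id" using tot nontriv by (auto simp: total_on_def)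
    \<comment> \<open>If \<open>y\<close> is positive, its inverse is negative.\<close>
    from left_invariant_strict[OF assms(1) inv _ _ _ this, of "inv\<^bsub>G\<^esub> y"]
    have "(inv\<^bsub>G\<^esub> y, \<one>\<^bsub>G\<^esub>) \<in> r - Id" using nontriv by simp
    then show ?thesis using nontriv(1) by blast
  qed (use nontriv in auto)
  then obtain t where t: "t \<in> carrier G" "(t, \<one>\<^bsub>G\<^esub>) \<in> r - Id" by blast
  have below: "w \<otimes>\<^bsub>G\<^esub> t \<in> carrier G" "(w \<otimes>\<^bsub>G\<^esub> t, w) \<in> r - Id" if "w \<in> carrier G" for w
    using left_invariant_strict[OF assms(1) inv that _ _ t(2)] that t(1) by simp_all
  have "\<exists>z\<in>carrier G. \<forall>b\<in>B. (z, b) \<in> r - Id"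
    using \<open>finite B\<close> \<open>B \<subseteq> carrier G\<close>
  proof (induction B)
    case empty
    then show ?case by auto
  next
    case (insert b B)
    then obtain z where z: "z \<in> carrier G" "\<forall>b\<in>B. (z, b) \<in> r - Id" by auto
    show ?case
    proof (cases "(z, b) \<in> r - Id")
      case True
      with z show ?thesis by auto
    next
      case False
      \<comment> \<open>Now \<open>b\<close> is at most the old bound \<open>z\<close>, so b t lies
        below \<open>b\<close>, below \<open>z\<close>, and hence below all of
        \<open>B\<close>.\<close>
      then have "b = z \<or> (b, z) \<in> r - Id"
        using z insert.prems tot by (auto simp: total_on_def)
      moreover have bt: "(b \<otimes>\<^bsub>G\<^esub> t, b) \<in> r - Id" using below(2) insert.prems by blast
      ultimately have "(b \<otimes>\<^bsub>G\<^esub> t, z) \<in> r - Id" by (metis transD[OF tr])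
      then have "\<forall>c\<in>insert b B. (b \<otimes>\<^bsub>G\<^esub> t, c) \<in> r - Id"
        using bt z(2) by (metis insertE transD[OF tr])
      then show ?thesis using below(1)[of b] insert.prems by blast
    qed
  qed
  then show thesis using that by blast
qed

lemma semigroup_generate_subset:
  assumes "group G" and "A \<subseteq> carrier G"
  shows "semigroup_generate G A \<subseteq> carrier G"
proof
  interpret group G by fact
  fix x assume "x \<in> semigroup_generate G A"
  then show "x \<in> carrier G" by induction (use assms in auto)
qed

text \<open>Of two distinct generators, at least one differs from that of any given letter;
  finiteness of \<open>S\<close> leaves only finitely many words of bounded length.\<close>

lemma positive_cone_free_group_not_finitely_generated:
  assumes "finite S" and "i \<in> S" "j \<in> S" "i \<noteq> j"
    and lin: "linear_order_on (carrier (free_group S)) r"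
    and inv: "left_invariant (free_group S) r"
  shows "\<not> finitely_generated_semigroup (free_group S) (positive_cone (free_group S) r)"
proof
  define G where "G = free_group S"
  interpret group G unfolding G_def by (rule group_free_group)
  have lin: "linear_order_on (carrier G) r" and inv: "left_invariant G r"
    using lin inv by (simp_all add: G_def)
  have carr: "carrier G = {w. reduced w \<and> fst ` set w \<subseteq> S}" and one: "\<one>\<^bsub>G\<^esub> = []"
    and mult_eq: "u \<otimes>\<^bsub>G\<^esub> v = foldr push_letter u v" for u v
    by (simp_all add: G_def free_group_def)
  have tr: "trans (r - Id)" and tot: "total_on (carrier G) r" and asym: "antisym r"
    using lin by (auto simp: order_on_defs intro: trans_diff_Id)
  note strict = left_invariant_strict[OF is_group inv]
  assume "finitely_generated_semigroup (free_group S) (positive_cone (free_group S) r)"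
  then obtain A where A: "finite A" "A \<subseteq> positive_cone G r"
    "semigroup_generate G A = positive_cone G r"
    by (auto simp: finitely_generated_semigroup_def G_def)
  have A_carr: "A \<subseteq> carrier G" using A(2) by (auto simp: positive_cone_def)
  from \<open>finite A\<close> obtain K where K: "\<And>a. a \<in> A \<Longrightarrow> length a \<le> K"
    by (metis finite_imageI finite_nat_set_iff_bounded_le imageI)
  define B where "B = {w \<in> carrier G. length w \<le> K}"
  have "finite {w :: 'a letter list. set w \<subseteq> S \<times> UNIV \<and> length w \<le> K}"
    using \<open>finite S\<close> by (intro finite_lists_length_le) simp
  then have "finite B"
    by (rule rev_finite_subset) (fastforce simp: B_def carr)
  moreover have "B \<subseteq> carrier G" by (auto simp: B_def)
  moreover have "[(i, True)] \<in> carrier G" "[(i, True)] \<noteq> \<one>\<^bsub>G\<^esub>"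
    using \<open>i \<in> S\<close> by (auto simp: carr one)
  ultimately obtain z where z: "z \<in> carrier G" "\<And>b. b \<in> B \<Longrightarrow> (z, b) \<in> r - Id"
    using left_order_finite_strict_lower_bound[OF is_group inv lin] by blast
  have long: "K < length u" if "u \<in> carrier G" "(u, z) \<in> r" for u
  proof (rule ccontr)
    assume "\<not> K < length u"
    with z(2)[of u] that asym show False by (auto simp: B_def dest: antisymD)
  qed
  \<comment> \<open>This walks back from \<open>v\<close> to \<open>u\<close> along the factors of
    \<open>p\<close>. Allowing \<open>v = z\<close> lets the walk start at \<open>z\<close>; with
    \<open>u\<close> and \<open>v\<close> arbitrary, an intermediate word can serve as either
    end.\<close>
  have step: "(u, z) \<in> r - Id \<and> hd u = hd v"
    if "p \<in> semigroup_generate G A" "u \<in> carrier G" "u \<otimes>\<^bsub>G\<^esub> p = v" "v = z \<or> (v, z) \<in> r - Id"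
    for p u v
    using that
  proof (induction p arbitrary: u v)
    case (incl a)
    then have "(\<one>\<^bsub>G\<^esub>, a) \<in> r - Id" "a \<in> carrier G"
      using A(2) by (auto simp: positive_cone_def)
    from strict[OF incl(2) _ this(2,1)] have "(u, v) \<in> r - Id" using incl by simp
    then have uz: "(u, z) \<in> r - Id" using incl(4) by (metis transD[OF tr])
    \<comment> \<open>The factor has length at most \<open>K\<close> and \<open>u\<close> is longer,
      so the first letter of \<open>u\<close> survives.\<close>
    then have "length a < length u" using long[of u] K[of a] incl by simp
    with incl uz show ?case using hd_foldr_push_letter[of u a] by (simp add: carr mult_eq)
  next
    case (mult a b)
    then have carr': "a \<in> carrier G" "b \<in> carrier G"
      using semigroup_generate_subset[OF is_group A_carr] by auto
    have "u \<otimes>\<^bsub>G\<^esub> a \<in> carrier G" "u \<otimes>\<^bsub>G\<^esub> a \<otimes>\<^bsub>G\<^esub> b = v"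
      using mult.prems(1,2) carr' by (simp_all add: m_assoc)
    \<comment> \<open>The right factor \<open>b\<close> is undone first, leading from
      \<open>v\<close> to u a; then \<open>a\<close> leads from u a to \<open>u\<close>.\<close>
    from mult.IH(2)[OF this mult.prems(3)]
    have ua: "(u \<otimes>\<^bsub>G\<^esub> a, z) \<in> r - Id" "hd (u \<otimes>\<^bsub>G\<^esub> a) = hd v" by simp_all
    from mult.IH(1)[OF mult.prems(1) refl disjI2[OF ua(1)]] ua(2) show ?case by metis
  qed
  have hd_below: "hd u = hd z" if "u \<in> carrier G" "(u, z) \<in> r - Id" for u
  proof -
    \<comment> \<open>The quotient of \<open>z\<close> by \<open>u\<close> is positive, hence a
      product of elements of \<open>A\<close> leading from \<open>u\<close> to
      \<open>z\<close>.\<close>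
    from strict[OF _ that(1) z(1) that(2), of "inv\<^bsub>G\<^esub> u"]
    have "inv\<^bsub>G\<^esub> u \<otimes>\<^bsub>G\<^esub> z \<in> positive_cone G r"
      using that z(1) by (auto simp: positive_cone_def)
    then show ?thesis
      using step[of "inv\<^bsub>G\<^esub> u \<otimes>\<^bsub>G\<^esub> z" u z] A(3) that(1) z(1)
      by (simp add: m_assoc[symmetric])
  qed
  \<comment> \<open>The empty word belongs to \<open>B\<close>, so \<open>z\<close> differs from it
    and \<open>hd z\<close> is a genuine letter.\<close>
  have "z \<noteq> []" using z(2)[of "[]"] by (auto simp: B_def carr)
  obtain k where k: "k \<in> S" "k \<noteq> fst (hd z)" using assms(2-4) by metis
  have above: "(z, [(k, e)] \<otimes>\<^bsub>G\<^esub> z) \<in> r - Id" "[(k, e)] \<in> carrier G" for e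
  proof -
    have eq: "[(k, e)] \<otimes>\<^bsub>G\<^esub> z = (k, e) # z"
      using k(2) \<open>z \<noteq> []\<close> by (cases z) (auto simp: mult_eq inv_letter_def)
    show e: "[(k, e)] \<in> carrier G" using k(1) by (simp add: carr)
    \<comment> \<open>A word whose first letter differs from that of \<open>z\<close> is not below
      \<open>z\<close>, so totality puts it above.\<close>
    have "hd ([(k, e)] \<otimes>\<^bsub>G\<^esub> z) \<noteq> hd z" using k(2) by (metis eq fst_conv list.sel(1))
    then have "([(k, e)] \<otimes>\<^bsub>G\<^esub> z, z) \<notin> r - Id" using hd_below e z(1) by blast
    moreover have "[(k, e)] \<otimes>\<^bsub>G\<^esub> z \<noteq> z" by (simp add: eq)
    ultimately show "(z, [(k, e)] \<otimes>\<^bsub>G\<^esub> z) \<in> r - Id"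
      using tot z(1) m_closed[OF e z(1)] unfolding total_on_def by (metis DiffI pair_in_Id_conv)
  qed
  have "[(k, True)] \<otimes>\<^bsub>G\<^esub> ([(k, False)] \<otimes>\<^bsub>G\<^esub> z) = z"
  proof -
    have "[(k, True)] \<otimes>\<^bsub>G\<^esub> [(k, False)] = \<one>\<^bsub>G\<^esub>" by (simp add: mult_eq one inv_letter_def)
    then show ?thesis using above(2) z(1) by (simp add: m_assoc[symmetric])
  qed
  then have "([(k, True)] \<otimes>\<^bsub>G\<^esub> z, z) \<in> r - Id"
    using strict[OF above(2)[of True] z(1) _ above(1)[of False]] above(2) z(1) by simp
  with above(1)[of True] asym show False by (auto dest: antisymD)
qed

theorem mainTheorem2:
  fixes n :: nat and r :: "nat letter list rel"
  assumes "n \<ge> 2"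
    and "linear_order_on (carrier (free_group {..<n})) r"
    and "left_invariant (free_group {..<n}) r"
  shows "\<not> finitely_generated_semigroup (free_group {..<n}) (positive_cone (free_group {..<n}) r)"
  \<comment> \<open>The generators 0 and 1 are distinct and both below \<open>n\<close>.\<close>
  using positive_cone_free_group_not_finitely_generated[of "{..<n}" 0 1 r] assms by simp

end
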